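(* Let $A^{C}\in\mathbb{R}^{M\times M}$ and $A^{G}\in\mathbb{R}^{N\times N}$ be symmetric matrices with eigenvalue decompositions $A^{C}=V^{C}\Lambda^{C}(V^{C})^\top$, $A^{G}=V^{G}\Lambda^{G}(V^{G})^\top$, where $V^{C},V^{G}$ are orthogonal with columns $v_i^{C}$ ($1\le i\le M$), $v_j^{G}$ ($1\le j\le N$), and $\Lambda^{C},\Lambda^{G}$ are diagonal with diagonal entries $\lambda_i^{C}$, $\lambda_j^{G}$ sorted in decreasing order. Let $h(\lambda^{C},\lambda^{G})=\sum_{i=0}^{T_G}\sum_{j=0}^{T_C}h_{ij}(\lambda^{C})^j(\lambda^{G})^i$ with $h_{ij}\in\mathbb{R}$ and $T_G,T_C\in\mathbb{Z}_+\cup\{\infty\}$ (convergent when an order is infinite), and let $\mathcal{H}(A^{C},A^{G})=\sum_{i=0}^{T_G}\sum_{j=0}^{T_C}h_{ij}(A^{C})^j\otimes(A^{G})^i$. Assume that the $NM$ numbers $|h(\lambda_j^{C},\lambda_i^{G})|$, $1\le i\le N$, $1\le j\le M$, are pairwise distinct. Let $x$ be a random vector in $\mathbb{R}^{NM}$ with $\mathbb{E}[x]=0$ and $\mathbb{E}[xx^\top]=I$, and let $y=\mathcal{H}(A^{C},A^{G})x$ (no observation noise). Write $y=(y_1;\dots;y_M)$ with consecutive blocks $y_m\in\mathbb{R}^N$, and set $Y=[y_1,\dots,y_M]\in\mathbb{R}^{N\times M}$, $C_y^{\mathsf{layer}}=\mathbb{E}[Y^\top Y]\in\mathbb{R}^{M\times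 M}$ and $C_y^{\mathsf{node}}=\mathbb{E}[YY^\top]\in\mathbb{R}^{N\times N}$. Then $$C_y^{\mathsf{layer}}=\sum_{i=1}^M v_i^{C}(v_i^{C})^\top\sum_{j=1}^N|h(\lambda_i^{C},\lambda_j^{G})|^2,\qquad C_y^{\mathsf{node}}=\sum_{j=1}^N v_j^{G}(v_j^{G})^\top\sum_{i=1}^M|h(\lambda_i^{C},\lambda_j^{G})|^2.$$
   Context: $\otimes$ is the Kronecker product. $A^C$ and $A^G$ are the weighted adjacency matrices of two undirected graphs (the coupling graph with $M$ nodes, whose nodes index layers/attributes, and the physical graph with $N$ nodes); $y$ is the multi-attribute graph signal organized layer by layer, and $Y$ is its unfolding. *)

theory Defs
  imports "HOL-Probability.Probability" "HOL-Library.Extended_Nat" "Jordan_Normal_Form.Matrix"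
begin

no_notation Finite_Cartesian_Product.vec_nth (infixl \<open>$\<close> 90)
hide_const (open) Finite_Cartesian_Product.vec Finite_Cartesian_Product.mat
hide_type (open) Finite_Cartesian_Product.vec

text \<open>Rows and columns are numbered from 0. The library predicate \<^const>\<open>orthogonal_mat\<close> only
  requires pairwise orthogonal nonzero columns, hence the separate definition.\<close>

definition orthonormal_mat :: "nat \<Rightarrow> real mat \<Rightarrow> bool" where
  "orthonormal_mat n V \<longleftrightarrow> V \<in> carrier_mat n n \<and>
     transpose_mat V * V = 1\<^sub>m n \<and> V * transpose_mat V = 1\<^sub>m n"

definition sorted_eigendecomposition :: "nat \<Rightarrow> real mat \<Rightarrow> real mat \<Rightarrow> real mat \<Rightarrow> bool" where
  "sorted_eigendecomposition n A V L \<longleftrightarrow>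
     orthonormal_mat n V \<and> L \<in> carrier_mat n n \<and> diagonal_mat L \<and>
     A = V * L * transpose_mat V \<and>
     (\<forall>i j. i \<le> j \<and> j < n \<longrightarrow> L $$ (j, j) \<le> L $$ (i, i))"

definition kronecker :: "real mat \<Rightarrow> real mat \<Rightarrow> real mat" where
  "kronecker A B = mat (dim_row A * dim_row B) (dim_col A * dim_col B)
     (\<lambda>(k, l). A $$ (k div dim_row B, l div dim_col B) * B $$ (k mod dim_row B, l mod dim_col B))"

definition outer_prod :: "real vec \<Rightarrow> real vec \<Rightarrow> real mat" where
  "outer_prod v w = mat (dim_vec v) (dim_vec w) (\<lambda>(i, j). v $ i * w $ j)"

definition mat_sum :: "nat \<Rightarrow> nat \<Rightarrow> ('i \<Rightarrow> real mat) \<Rightarrow> 'i set \<Rightarrow> real mat" where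
  "mat_sum r c F I = mat r c (\<lambda>(k, l). \<Sum>i\<in>I. F i $$ (k, l))"

definition unfolding_mat :: "nat \<Rightarrow> nat \<Rightarrow> real vec \<Rightarrow> real mat" where
  "unfolding_mat N M y = mat N M (\<lambda>(i, m). y $ (m * N + i))"

text \<open>\<open>sum_upto T f\<close> is the sum of \<open>f i\<close> over \<open>0 \<le> i \<le> T\<close>; for \<open>T = \<infinity>\<close> it is the limit of the
  partial sums, meaningful under \<open>summable_upto T f\<close>.\<close>

definition sum_upto :: "enat \<Rightarrow> (nat \<Rightarrow> real) \<Rightarrow> real" where
  "sum_upto T f = (case T of enat n \<Rightarrow> (\<Sum>i\<le>n. f i) | \<infinity> \<Rightarrow> (\<Sum>i. f i))"

definition summable_upto :: "enat \<Rightarrow> (nat \<Rightarrow> real) \<Rightarrow> bool" where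
  "summable_upto T f \<longleftrightarrow> (T = \<infinity> \<longrightarrow> summable f)"

definition filter_fun :: "enat \<Rightarrow> enat \<Rightarrow> (nat \<Rightarrow> nat \<Rightarrow> real) \<Rightarrow> real \<Rightarrow> real \<Rightarrow> real" where
  "filter_fun TG TC h a b = sum_upto TG (\<lambda>i. sum_upto TC (\<lambda>j. h i j * a ^ j * b ^ i))"

text \<open>Convergence is that of the iterated series, with no absolute convergence required. For
  symmetric matrices, convergence at every pair of eigenvalues is equivalent to entrywise
  convergence of the matrix series in \<open>filter_mat\<close>.\<close>

definition filter_convergent :: "enat \<Rightarrow> enat \<Rightarrow> (nat \<Rightarrow> nat \<Rightarrow> real) \<Rightarrow> real \<Rightarrow> real \<Rightarrow> bool" where
  "filter_convergent TG TC h a b \<longleftrightarrow>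
     (\<forall>i. enat i \<le> TG \<longrightarrow> summable_upto TC (\<lambda>j. h i j * a ^ j * b ^ i)) \<and>
     summable_upto TG (\<lambda>i. sum_upto TC (\<lambda>j. h i j * a ^ j * b ^ i))"

definition filter_mat ::
  "enat \<Rightarrow> enat \<Rightarrow> (nat \<Rightarrow> nat \<Rightarrow> real) \<Rightarrow> real mat \<Rightarrow> real mat \<Rightarrow> real mat" where
  "filter_mat TG TC h A B = mat (dim_row A * dim_row B) (dim_col A * dim_col B)
     (\<lambda>(k, l). sum_upto TG (\<lambda>i. sum_upto TC (\<lambda>j.
        (h i j \<cdot>\<^sub>m kronecker (A ^\<^sub>m j) (B ^\<^sub>m i)) $$ (k, l))))"

definition random_vec :: "'a measure \<Rightarrow> nat \<Rightarrow> ('a \<Rightarrow> real vec) \<Rightarrow> bool" where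
  "random_vec P n x \<longleftrightarrow> (\<forall>\<omega>\<in>space P. x \<omega> \<in> carrier_vec n) \<and>
     (\<forall>k<n. (\<lambda>\<omega>. x \<omega> $ k) \<in> borel_measurable P)"

definition expectation_vec :: "'a measure \<Rightarrow> nat \<Rightarrow> ('a \<Rightarrow> real vec) \<Rightarrow> real vec" where
  "expectation_vec P n x = vec n (\<lambda>k. \<integral>\<omega>. x \<omega> $ k \<partial>P)"

definition expectation_mat :: "'a measure \<Rightarrow> nat \<Rightarrow> nat \<Rightarrow> ('a \<Rightarrow> real mat) \<Rightarrow> real mat" where
  "expectation_mat P r c X = mat r c (\<lambda>(k, l). \<integral>\<omega>. X \<omega> $$ (k, l) \<partial>P)"

text \<open>A non-integrable entry has Bochner integral 0. This is harmless for a random vector with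
  second-moment matrix \<open>1\<^sub>m n\<close>: the diagonal entries being 1 forces every component to be
  square-integrable, so all first and second moments exist.\<close>

end

theory Submission
  imports Defs
begin

text \<open>The vectors \<open>v\<^sub>a\<^sup>C \<otimes> v\<^sub>b\<^sup>G\<close> form an orthonormal eigenbasis of the filter with eigenvalues
  \<open>h(\<lambda>\<^sub>a\<^sup>C, \<lambda>\<^sub>b\<^sup>G)\<close>. Since \<open>x\<close> is white, the covariance of \<open>y\<close> is the filter times its transpose,
  hence diagonal in this basis with eigenvalues \<open>h\<^sup>2\<close>. The two matrices in question are partial
  traces of this covariance, and each partial trace removes one factor because the
  eigenvectors \<open>v\<^sub>b\<^sup>G\<close> and \<open>v\<^sub>a\<^sup>C\<close> are unit vectors.\<close>

section \<open>Orthonormal expansions and block indices\<close>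

text \<open>Parseval's identity: after expanding and reordering, the sum over \<open>R\<close>
  produces the Gram matrix of the family \<open>u\<close>, which is the identity. It later
  multiplies spectral sums, once for matrix powers and once for the filter times its
  transpose.\<close>

lemma sum_mult_orthonormal:
  fixes p q :: "'s \<Rightarrow> real" and u :: "'s \<Rightarrow> 'r \<Rightarrow> real"
  assumes "finite S"
    and orth: "\<And>a b. a \<in> S \<Longrightarrow> b \<in> S \<Longrightarrow> (\<Sum>r\<in>R. u a r * u b r) = (if a = b then 1 else 0)"
  shows "(\<Sum>r\<in>R. (\<Sum>a\<in>S. p a * u a r) * (\<Sum>b\<in>S. q b * u b r)) = (\<Sum>a\<in>S. p a * q a)"
proof -
  have "(\<Sum>r\<in>R. (\<Sum>a\<in>S. p a * u a r) * (\<Sum>b\<in>S. q b * u b r)) =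
      (\<Sum>r\<in>R. \<Sum>a\<in>S. \<Sum>b\<in>S. p a * q b * (u a r * u b r))"
    by (simp add: sum_product mult_ac)
  also have "\<dots> = (\<Sum>a\<in>S. \<Sum>r\<in>R. \<Sum>b\<in>S. p a * q b * (u a r * u b r))"
    by (rule sum.swap)
  also have "\<dots> = (\<Sum>a\<in>S. \<Sum>b\<in>S. \<Sum>r\<in>R. p a * q b * (u a r * u b r))"
    by (intro sum.cong refl sum.swap)
  also have "\<dots> = (\<Sum>a\<in>S. \<Sum>b\<in>S. p a * q b * (\<Sum>r\<in>R. u a r * u b r))"
    by (simp add: sum_distrib_left)
  also have "\<dots> = (\<Sum>a\<in>S. \<Sum>b\<in>S. if a = b then p a * q b else 0)"
    by (intro sum.cong refl) (simp add: orth)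
  also have "\<dots> = (\<Sum>a\<in>S. p a * q a)"
    using \<open>finite S\<close> by simp
  finally show ?thesis .
qed

text \<open>Separates an index of the stacked signal into its layer \<open>m\<close> and its node
  \<open>i\<close>, the same layout as in \<open>unfolding_mat\<close>.\<close>

lemma sum_lessThan_mult:
  fixes f :: "nat \<Rightarrow> real"
  shows "(\<Sum>k<N * M. f k) = (\<Sum>m<M. \<Sum>i<N. f (m * N + i))"
proof -
  have "(\<Sum>k<N * M. f k) = (\<Sum>m<M. sum f {m * N..<m * N + N})"
    using sum.nat_group[of f N M] by (simp add: mult.commute)
  also have "\<dots> = (\<Sum>m<M. \<Sum>i<N. f (m * N + i))"
  proof (rule sum.cong[OF refl])
    fix m
    show "sum f {m * N..<m * N + N} = (\<Sum>i<N. f (m * N + i))"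
      using sum.shift_bounds_nat_ivl[of f 0 "m * N" N] by (simp add: add.commute lessThan_atLeast0)
  qed
  finally show ?thesis .
qed

lemma mult_add_less:
  fixes m i M N :: nat
  assumes "m < M" "i < N"
  shows "m * N + i < N * M"
proof -
  have "m * N + i < Suc m * N" using assms by simp
  also have "\<dots> \<le> M * N" using assms by (intro mult_le_mono1) simp
  finally show ?thesis by (simp add: mult.commute)
qed

section \<open>Entries of symmetric matrices and their powers in an eigenbasis\<close>

lemma orthonormal_mat_cols:
  assumes "orthonormal_mat n V" "a < n" "b < n"
  shows "(\<Sum>r<n. V $$ (r, a) * V $$ (r, b)) = (if a = b then 1 else 0)"
proof -
  have V: "V \<in> carrier_mat n n" and "transpose_mat V * V = 1\<^sub>m n"
    using assms(1) by (auto simp: orthonormal_mat_def)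
  then have "(transpose_mat V * V) $$ (a, b) = (if a = b then 1 else 0)"
    using assms by simp
  then show ?thesis
    using V assms by (simp add: scalar_prod_def lessThan_atLeast0)
qed

lemma orthonormal_mat_rows:
  assumes "orthonormal_mat n V" "k < n" "l < n"
  shows "(\<Sum>a<n. V $$ (k, a) * V $$ (l, a)) = (if k = l then 1 else 0)"
proof -
  have V: "V \<in> carrier_mat n n" and "V * transpose_mat V = 1\<^sub>m n"
    using assms(1) by (auto simp: orthonormal_mat_def)
  then have "(V * transpose_mat V) $$ (k, l) = (if k = l then 1 else 0)"
    using assms by simp
  then show ?thesis
    using V assms by (simp add: scalar_prod_def lessThan_atLeast0)
qed

text \<open>Diagonality of \<open>L\<close> leaves one term in each entry of \<open>V * L\<close>,
  so the triple product becomes a single sum over eigenvectors.\<close>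

lemma sorted_eigendecomposition_index:
  assumes "sorted_eigendecomposition n A V L" "k < n" "l < n"
  shows "A $$ (k, l) = (\<Sum>a<n. L $$ (a, a) * V $$ (k, a) * V $$ (l, a))"
proof -
  have V: "V \<in> carrier_mat n n" and L: "L \<in> carrier_mat n n" and "diagonal_mat L"
    and A: "A = V * L * transpose_mat V"
    using assms(1) by (auto simp: sorted_eigendecomposition_def orthonormal_mat_def)
  have diag: "L $$ (b, a) = 0" if "a < n" "b < n" "b \<noteq> a" for a b
    using \<open>diagonal_mat L\<close> L that by (auto simp: diagonal_mat_def)
  have VL: "(V * L) $$ (k, a) = L $$ (a, a) * V $$ (k, a)" if "a < n" for a
  proof -
    have "(V * L) $$ (k, a) = (\<Sum>b<n. V $$ (k, b) * L $$ (b, a))"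
      using V L that \<open>k < n\<close> by (simp add: scalar_prod_def lessThan_atLeast0)
    also have "\<dots> = (\<Sum>b<n. if b = a then V $$ (k, a) * L $$ (a, a) else 0)"
      by (intro sum.cong refl) (use that in \<open>simp add: diag\<close>)
    also have "\<dots> = L $$ (a, a) * V $$ (k, a)"
      using that by simp
    finally show ?thesis .
  qed
  have "(W * transpose_mat V) $$ (k, l) = (\<Sum>a<n. W $$ (k, a) * V $$ (l, a))"
    if "W \<in> carrier_mat n n" for W
    using V that assms(2,3) by (simp add: scalar_prod_def lessThan_atLeast0)
  from this[OF mult_carrier_mat[OF V L]]
  have "A $$ (k, l) = (\<Sum>a<n. (V * L) $$ (k, a) * V $$ (l, a))"
    unfolding A .
  then show ?thesis
    by (simp add: VL)
qed

text \<open>Induction on the exponent: orthonormality of the eigenvectors removes the cross terms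
  when one more factor \<open>A\<close> is multiplied on, and the eigenvalues multiply.\<close>

lemma sorted_eigendecomposition_pow_index:
  assumes "sorted_eigendecomposition n A V L" "k < n" "l < n"
  shows "(A ^\<^sub>m j) $$ (k, l) = (\<Sum>a<n. L $$ (a, a) ^ j * V $$ (k, a) * V $$ (l, a))"
proof -
  have V: "orthonormal_mat n V" and A: "A \<in> carrier_mat n n"
    using assms(1) by (auto simp: sorted_eigendecomposition_def orthonormal_mat_def)
  show ?thesis
    using assms(2,3)
  proof (induction j arbitrary: k l)
    \<comment> \<open>The zeroth power is the identity, so this is the completeness relation given
      by the orthonormal rows of \<open>V\<close>.\<close>
    case 0
    then show ?case
      using A orthonormal_mat_rows[OF V, of k l] by simp
  next
    case (Suc j)
    have "(A ^\<^sub>m Suc j) $$ (k, l) = (\<Sum>r<n. (A ^\<^sub>m j) $$ (k, r) * A $$ (r, l))"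
      using A Suc.prems pow_carrier_mat[OF A, of j]
      by (simp add: scalar_prod_def lessThan_atLeast0)
    \<comment> \<open>Both factors are expanded in the columns of \<open>V\<close> evaluated at the
      summation index \<open>r\<close>, the shape required by Parseval's identity.\<close>
    also have "\<dots> = (\<Sum>r<n. (\<Sum>a<n. (L $$ (a, a) ^ j * V $$ (k, a)) * V $$ (r, a)) *
        (\<Sum>a<n. (L $$ (a, a) * V $$ (l, a)) * V $$ (r, a)))"
      by (intro sum.cong refl)
        (use Suc.prems in \<open>simp add: Suc.IH sorted_eigendecomposition_index[OF assms(1)] mult_ac\<close>)
    also have "\<dots> = (\<Sum>a<n. (L $$ (a, a) ^ j * V $$ (k, a)) * (L $$ (a, a) * V $$ (l, a)))"
      by (intro sum_mult_orthonormal[where u = "\<lambda>a r. V $$ (r, a)"])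
        (auto simp: orthonormal_mat_cols[OF V])
    finally show ?case
      by (simp add: mult_ac)
  qed
qed

section \<open>Linearity of finite or infinite filter series\<close>

lemma sum_upto_cong:
  assumes "\<And>i. enat i \<le> T \<Longrightarrow> f i = g i"
  shows "sum_upto T f = sum_upto T g"
proof (cases T)
  case (enat n)
  then show ?thesis
    using assms by (simp add: sum_upto_def)
next
  case infinity
  then have "f = g"
    using assms by (intro ext) simp
  then show ?thesis
    by simp
qed

text \<open>For a finite order this is a swap of finite sums; for an infinite order, summability of
  each \<open>f s\<close> justifies taking the limit termwise in \<open>s\<close>.\<close>

lemma sum_upto_linear:
  assumes "\<And>s. s \<in> S \<Longrightarrow> summable_upto T (f s)"
  shows "sum_upto T (\<lambda>i. \<Sum>s\<in>S. c s * f s i) = (\<Sum>s\<in>S. c s * sum_upto T (f s))"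
proof (cases T)
  case (enat n)
  then show ?thesis
    by (simp add: sum_upto_def sum_distrib_left sum.swap[of _ S])
next
  case infinity
  then have "summable (f s)" if "s \<in> S" for s
    using assms that by (simp add: summable_upto_def)
  with infinity show ?thesis
    by (simp add: sum_upto_def suminf_sum suminf_mult summable_mult)
qed

text \<open>Carries convergence at eigenvalue pairs over to matrix entries, which are linear
  combinations of scalar filter series. Linearity is applied to the inner series for each
  \<open>i\<close> and then to the outer one, matching the two clauses of
  \<open>filter_convergent\<close>.\<close>

lemma filter_fun_linear:
  assumes "\<And>s. s \<in> S \<Longrightarrow> filter_convergent TG TC h (a s) (b s)"
  shows "sum_upto TG (\<lambda>i. sum_upto TC (\<lambda>j. \<Sum>s\<in>S. c s * (h i j * a s ^ j * b s ^ i))) =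
    (\<Sum>s\<in>S. c s * filter_fun TG TC h (a s) (b s))"
proof -
  have "sum_upto TG (\<lambda>i. sum_upto TC (\<lambda>j. \<Sum>s\<in>S. c s * (h i j * a s ^ j * b s ^ i))) =
      sum_upto TG (\<lambda>i. \<Sum>s\<in>S. c s * sum_upto TC (\<lambda>j. h i j * a s ^ j * b s ^ i))"
    using assms by (intro sum_upto_cong sum_upto_linear) (auto simp: filter_convergent_def)
  also have "\<dots> = (\<Sum>s\<in>S. c s * filter_fun TG TC h (a s) (b s))"
    unfolding filter_fun_def
    using assms by (intro sum_upto_linear) (auto simp: filter_convergent_def)
  finally show ?thesis .
qed

section \<open>Kronecker eigenvectors and the spectral form of the filter\<close>

text \<open>Component \<open>k\<close> of the Kronecker product of column \<open>a\<close> of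
  \<open>V\<close> and column \<open>b\<close> of \<open>W\<close>. Pairing the two column numbers
  lets the family be indexed by one product set, as Parseval's identity expects.\<close>

definition kron_eigvec :: "nat \<Rightarrow> real mat \<Rightarrow> real mat \<Rightarrow> nat \<times> nat \<Rightarrow> nat \<Rightarrow> real" where
  "kron_eigvec N V W = (\<lambda>(a, b) k. V $$ (k div N, a) * W $$ (k mod N, b))"

lemma kron_eigvec_block:
  assumes "i < N"
  shows "kron_eigvec N V W (a, b) (m * N + i) = V $$ (m, a) * W $$ (i, b)"
  using assms by (simp add: kron_eigvec_def)

text \<open>The inner product of two Kronecker products is the product of the inner products of
  their factors.\<close>

lemma kron_eigvec_orthonormal:
  assumes "orthonormal_mat M V" "orthonormal_mat N W"
    and "s \<in> {..<M} \<times> {..<N}" "t \<in> {..<M} \<times> {..<N}"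
  shows "(\<Sum>k<N * M. kron_eigvec N V W s k * kron_eigvec N V W t k) = (if s = t then 1 else 0)"
proof -
  obtain a b c d where s: "s = (a, b)" and t: "t = (c, d)" by (cases s, cases t)
  have "(\<Sum>k<N * M. kron_eigvec N V W s k * kron_eigvec N V W t k) =
      (\<Sum>m<M. \<Sum>i<N. (V $$ (m, a) * V $$ (m, c)) * (W $$ (i, b) * W $$ (i, d)))"
    unfolding sum_lessThan_mult s t by (simp add: kron_eigvec_block mult_ac)
  also have "\<dots> = (\<Sum>m<M. V $$ (m, a) * V $$ (m, c)) * (\<Sum>i<N. W $$ (i, b) * W $$ (i, d))"
    by (simp add: sum_product)
  also have "\<dots> = (if s = t then 1 else 0)"
    using assms by (simp add: s t orthonormal_mat_cols)
  finally show ?thesis .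
qed

lemma kronecker_carrier:
  assumes "X \<in> carrier_mat M M" "Y \<in> carrier_mat N N"
  shows "kronecker X Y \<in> carrier_mat (N * M) (N * M)"
  using assms by (simp add: kronecker_def mult.commute)

lemma kronecker_index:
  assumes "X \<in> carrier_mat M M" "Y \<in> carrier_mat N N" "k < N * M" "l < N * M"
  shows "kronecker X Y $$ (k, l) = X $$ (k div N, l div N) * Y $$ (k mod N, l mod N)"
  using assms by (simp add: kronecker_def mult.commute)

text \<open>Every term \<open>h i j\<close> times \<open>A^j \<otimes> B^i\<close> is diagonal in
  the common basis \<open>kron_eigvec\<close>, so summing the series only sums the
  eigenvalues.\<close>

lemma filter_mat_index:
  assumes A: "A \<in> carrier_mat M M" and B: "B \<in> carrier_mat N N"
    and VL: "sorted_eigendecomposition M A V L" and WK: "sorted_eigendecomposition N B W K"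
    and conv: "\<forall>i<M. \<forall>j<N. filter_convergent TG TC h (L $$ (i, i)) (K $$ (j, j))"
    and kl: "k < N * M" "l < N * M"
  shows "filter_mat TG TC h A B $$ (k, l) =
    (\<Sum>(a, b)\<in>{..<M} \<times> {..<N}. filter_fun TG TC h (L $$ (a, a)) (K $$ (b, b)) *
      kron_eigvec N V W (a, b) k * kron_eigvec N V W (a, b) l)"
proof -
  let ?S = "{..<M} \<times> {..<N}"
  let ?u = "kron_eigvec N V W"
  \<comment> \<open>An index below \<open>N * M\<close> exists, so \<open>N\<close> is positive and
    remainders modulo \<open>N\<close> are valid node indices.\<close>
  have N: "0 < N" using kl by (cases N) auto
  have div: "k div N < M" "l div N < M" "k mod N < N" "l mod N < N"
    using kl N by (auto simp: less_mult_imp_div_less mult.commute)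
  \<comment> \<open>The eigenvector weight is independent of \<open>i\<close> and \<open>j\<close>;
    it is put in front to serve as the coefficient in \<open>filter_fun_linear\<close>.\<close>
  have entry: "(h i j \<cdot>\<^sub>m kronecker (A ^\<^sub>m j) (B ^\<^sub>m i)) $$ (k, l) =
      (\<Sum>s\<in>?S. (?u s k * ?u s l) * (h i j * (L $$ (fst s, fst s)) ^ j * (K $$ (snd s, snd s)) ^ i))"
    for i j
  proof -
    note pows = pow_carrier_mat[OF A, of j] pow_carrier_mat[OF B, of i]
    have "(h i j \<cdot>\<^sub>m kronecker (A ^\<^sub>m j) (B ^\<^sub>m i)) $$ (k, l) =
        h i j * ((A ^\<^sub>m j) $$ (k div N, l div N) * (B ^\<^sub>m i) $$ (k mod N, l mod N))"
      using kl kronecker_carrier[OF pows]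
      by (simp only: carrier_matD index_smult_mat(1) kronecker_index[OF pows kl])
    also have "\<dots> = h i j * (\<Sum>(a, b)\<in>?S.
        (L $$ (a, a) ^ j * V $$ (k div N, a) * V $$ (l div N, a)) *
        (K $$ (b, b) ^ i * W $$ (k mod N, b) * W $$ (l mod N, b)))"
      by (simp only: sorted_eigendecomposition_pow_index[OF VL div(1,2)]
          sorted_eigendecomposition_pow_index[OF WK div(3,4)] sum_product sum.cartesian_product)
    also have "\<dots> = (\<Sum>s\<in>?S. (?u s k * ?u s l) *
        (h i j * (L $$ (fst s, fst s)) ^ j * (K $$ (snd s, snd s)) ^ i))"
      by (simp add: sum_distrib_left kron_eigvec_def split_def mult_ac)
    finally show ?thesis .
  qed
  have "filter_mat TG TC h A B $$ (k, l) = sum_upto TG (\<lambda>i. sum_upto TC (\<lambda>j. \<Sum>s\<in>?S.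
      (?u s k * ?u s l) * (h i j * (L $$ (fst s, fst s)) ^ j * (K $$ (snd s, snd s)) ^ i)))"
    using A B kl by (simp add: filter_mat_def entry mult.commute[of M N] del: index_smult_mat)
  also have "\<dots> = (\<Sum>s\<in>?S. (?u s k * ?u s l) *
      filter_fun TG TC h (L $$ (fst s, fst s)) (K $$ (snd s, snd s)))"
    using conv by (intro filter_fun_linear) auto
  finally show ?thesis
    by (simp add: split_def mult_ac)
qed

text \<open>The left side is an entry of the filter times its transpose. Parseval's identity keeps
  the eigenvectors and squares the eigenvalues.\<close>

lemma filter_mat_gram_index:
  assumes A: "A \<in> carrier_mat M M" and B: "B \<in> carrier_mat N N"
    and VL: "sorted_eigendecomposition M A V L" and WK: "sorted_eigendecomposition N B W K"
    and conv: "\<forall>i<M. \<forall>j<N. filter_convergent TG TC h (L $$ (i, i)) (K $$ (j, j))"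
    and kl: "k < N * M" "l < N * M"
  shows "(\<Sum>p<N * M. filter_mat TG TC h A B $$ (k, p) * filter_mat TG TC h A B $$ (l, p)) =
    (\<Sum>(a, b)\<in>{..<M} \<times> {..<N}. (filter_fun TG TC h (L $$ (a, a)) (K $$ (b, b)))\<^sup>2 *
      kron_eigvec N V W (a, b) k * kron_eigvec N V W (a, b) l)"
proof -
  let ?S = "{..<M} \<times> {..<N}"
  let ?u = "kron_eigvec N V W"
  let ?g = "\<lambda>s. filter_fun TG TC h (L $$ (fst s, fst s)) (K $$ (snd s, snd s))"
  have orth: "orthonormal_mat M V" "orthonormal_mat N W"
    using VL WK by (auto simp: sorted_eigendecomposition_def)
  have "(\<Sum>p<N * M. filter_mat TG TC h A B $$ (k, p) * filter_mat TG TC h A B $$ (l, p)) =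
      (\<Sum>p<N * M. (\<Sum>s\<in>?S. (?g s * ?u s k) * ?u s p) * (\<Sum>s\<in>?S. (?g s * ?u s l) * ?u s p))"
    by (intro sum.cong refl)
      (use kl in \<open>simp add: filter_mat_index[OF A B VL WK conv] split_def\<close>)
  also have "\<dots> = (\<Sum>s\<in>?S. (?g s * ?u s k) * (?g s * ?u s l))"
    by (intro sum_mult_orthonormal kron_eigvec_orthonormal[OF orth]) auto
  finally show ?thesis
    by (simp add: split_def power2_eq_square mult_ac)
qed

section \<open>Second moments of a white vector and of its linear image\<close>

lemma white_vec_second_moment:
  assumes "random_vec P n x"
    and white: "expectation_mat P n n (\<lambda>\<omega>. outer_prod (x \<omega>) (x \<omega>)) = 1\<^sub>m n"
    and "k < n" "l < n"
  shows "integrable P (\<lambda>\<omega>. x \<omega> $ k * x \<omega> $ l)"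
    and "(\<integral>\<omega>. x \<omega> $ k * x \<omega> $ l \<partial>P) = (if k = l then 1 else 0)"
proof -
  have dim: "dim_vec (x \<omega>) = n" if "\<omega> \<in> space P" for \<omega>
    using assms(1) that by (auto simp: random_vec_def)
  have meas: "(\<lambda>\<omega>. x \<omega> $ i) \<in> borel_measurable P" if "i < n" for i
    using assms(1) that by (auto simp: random_vec_def)
  have moment: "(\<integral>\<omega>. x \<omega> $ i * x \<omega> $ j \<partial>P) = (if i = j then 1 else 0)" if "i < n" "j < n" for i j
  proof -
    have "(\<integral>\<omega>. x \<omega> $ i * x \<omega> $ j \<partial>P) = (\<integral>\<omega>. outer_prod (x \<omega>) (x \<omega>) $$ (i, j) \<partial>P)"
      by (intro Bochner_Integration.integral_cong refl) (use dim that in \<open>simp add: outer_prod_def\<close>)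
    also have "\<dots> = expectation_mat P n n (\<lambda>\<omega>. outer_prod (x \<omega>) (x \<omega>)) $$ (i, j)"
      using that by (simp add: expectation_mat_def)
    finally show ?thesis
      using that by (simp add: white)
  qed
  \<comment> \<open>A non-integrable square would have Bochner integral 0, whereas the diagonal
    moment is 1.\<close>
  have square: "integrable P (\<lambda>\<omega>. x \<omega> $ i * x \<omega> $ i)" if "i < n" for i
    using moment[OF that that] not_integrable_integral_eq by fastforce
  show "integrable P (\<lambda>\<omega>. x \<omega> $ k * x \<omega> $ l)"
  proof (rule Bochner_Integration.integrable_bound)
    show "integrable P (\<lambda>\<omega>. x \<omega> $ k * x \<omega> $ k + x \<omega> $ l * x \<omega> $ l)"
      using square assms(3,4) by simp
    show "(\<lambda>\<omega>. x \<omega> $ k * x \<omega> $ l) \<in> borel_measurable P"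
      using meas assms(3,4) by simp
    \<comment> \<open>Follows from
      \<open>2 * \<bar>s\<bar> * \<bar>t\<bar> \<le> s * s + t * t\<close>; the squares thus
      dominate the mixed products.\<close>
    have "\<bar>s * t\<bar> \<le> \<bar>s * s + t * t\<bar>" for s t :: real
      using sum_squares_bound[of "\<bar>s\<bar>" "\<bar>t\<bar>"] mult_nonneg_nonneg[of "\<bar>s\<bar>" "\<bar>t\<bar>"]
      unfolding abs_mult power2_eq_square abs_mult_self_eq by linarith
    then show "AE \<omega> in P. norm (x \<omega> $ k * x \<omega> $ l) \<le> norm (x \<omega> $ k * x \<omega> $ k + x \<omega> $ l * x \<omega> $ l)"
      by simp
  qed
  show "(\<integral>\<omega>. x \<omega> $ k * x \<omega> $ l \<partial>P) = (if k = l then 1 else 0)"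
    using moment assms(3,4) by simp
qed

text \<open>Expanding both components gives a double sum of moments of \<open>x\<close>, of which
  whiteness keeps only the terms with \<open>p = q\<close>.\<close>

lemma white_vec_image_second_moment:
  assumes x: "random_vec P n x"
    and white: "expectation_mat P n n (\<lambda>\<omega>. outer_prod (x \<omega>) (x \<omega>)) = 1\<^sub>m n"
    and H: "H \<in> carrier_mat n n" and kl: "k < n" "l < n"
  shows "integrable P (\<lambda>\<omega>. (H *\<^sub>v x \<omega>) $ k * (H *\<^sub>v x \<omega>) $ l)"
    and "(\<integral>\<omega>. (H *\<^sub>v x \<omega>) $ k * (H *\<^sub>v x \<omega>) $ l \<partial>P) = (\<Sum>p<n. H $$ (k, p) * H $$ (l, p))"
proof -
  let ?f = "\<lambda>\<omega>. \<Sum>p<n. \<Sum>q<n. (H $$ (k, p) * H $$ (l, q)) * (x \<omega> $ p * x \<omega> $ q)"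
  \<comment> \<open>The dimension of \<open>x \<omega>\<close> is known only on
    \<open>space P\<close>, which is all that integrals and integrability depend on.\<close>
  have eq: "(H *\<^sub>v x \<omega>) $ k * (H *\<^sub>v x \<omega>) $ l = ?f \<omega>" if "\<omega> \<in> space P" for \<omega>
  proof -
    have "dim_vec (x \<omega>) = n"
      using x that by (auto simp: random_vec_def)
    then have "(H *\<^sub>v x \<omega>) $ r = (\<Sum>p<n. H $$ (r, p) * x \<omega> $ p)" if "r < n" for r
      using H that by (simp add: scalar_prod_def lessThan_atLeast0)
    then show ?thesis
      using kl by (simp add: sum_product mult_ac)
  qed
  have int: "integrable P (\<lambda>\<omega>. (H $$ (k, p) * H $$ (l, q)) * (x \<omega> $ p * x \<omega> $ q))"
    if "p < n" "q < n" for p q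
    by (intro integrable_mult_right white_vec_second_moment(1)[OF x white that])
  have "integrable P ?f"
    using int by (intro Bochner_Integration.integrable_sum) auto
  then show "integrable P (\<lambda>\<omega>. (H *\<^sub>v x \<omega>) $ k * (H *\<^sub>v x \<omega>) $ l)"
    by (subst Bochner_Integration.integrable_cong[OF refl eq])
  have "(\<integral>\<omega>. (H *\<^sub>v x \<omega>) $ k * (H *\<^sub>v x \<omega>) $ l \<partial>P) = (\<integral>\<omega>. ?f \<omega> \<partial>P)"
    by (intro Bochner_Integration.integral_cong refl eq)
  also have "\<dots> = (\<Sum>p<n. \<integral>\<omega>. (\<Sum>q<n. (H $$ (k, p) * H $$ (l, q)) * (x \<omega> $ p * x \<omega> $ q)) \<partial>P)"
    using int by (intro Bochner_Integration.integral_sum Bochner_Integration.integrable_sum) auto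
  also have "\<dots> = (\<Sum>p<n. \<Sum>q<n. \<integral>\<omega>. (H $$ (k, p) * H $$ (l, q)) * (x \<omega> $ p * x \<omega> $ q) \<partial>P)"
    using int by (intro sum.cong refl Bochner_Integration.integral_sum) auto
  also have "\<dots> = (\<Sum>p<n. \<Sum>q<n. if p = q then H $$ (k, p) * H $$ (l, q) else 0)"
    by (intro sum.cong refl) (simp add: white_vec_second_moment(2)[OF x white])
  also have "\<dots> = (\<Sum>p<n. H $$ (k, p) * H $$ (l, p))"
    by simp
  finally show "(\<integral>\<omega>. (H *\<^sub>v x \<omega>) $ k * (H *\<^sub>v x \<omega>) $ l \<partial>P) = (\<Sum>p<n. H $$ (k, p) * H $$ (l, p))" .
qed

section \<open>The layer and node covariances as partial traces\<close>

theorem proposition2: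
  fixes M N :: nat
    and AC VC LC AG VG LG :: "real mat"
    and TG TC :: enat
    and h :: "nat \<Rightarrow> nat \<Rightarrow> real"
    and P :: "'a measure"
    and x y :: "'a \<Rightarrow> real vec"
    and Y :: "'a \<Rightarrow> real mat"
  assumes "AC \<in> carrier_mat M M" and "transpose_mat AC = AC"
    and "AG \<in> carrier_mat N N" and "transpose_mat AG = AG"
    and "sorted_eigendecomposition M AC VC LC"
    and "sorted_eigendecomposition N AG VG LG"
    and "\<forall>i<M. \<forall>j<N. filter_convergent TG TC h (LC $$ (i, i)) (LG $$ (j, j))"
    and "inj_on (\<lambda>(j, i). \<bar>filter_fun TG TC h (LC $$ (j, j)) (LG $$ (i, i))\<bar>) ({..<M} \<times> {..<N})"
    and "prob_space P"
    and "random_vec P (N * M) x"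
    and "expectation_vec P (N * M) x = 0\<^sub>v (N * M)"
    and "expectation_mat P (N * M) (N * M) (\<lambda>\<omega>. outer_prod (x \<omega>) (x \<omega>)) = 1\<^sub>m (N * M)"
    and "y = (\<lambda>\<omega>. filter_mat TG TC h AC AG *\<^sub>v x \<omega>)"
    and "Y = (\<lambda>\<omega>. unfolding_mat N M (y \<omega>))"
  shows "expectation_mat P M M (\<lambda>\<omega>. transpose_mat (Y \<omega>) * Y \<omega>) =
      mat_sum M M (\<lambda>i. (\<Sum>j<N. \<bar>filter_fun TG TC h (LC $$ (i, i)) (LG $$ (j, j))\<bar>\<^sup>2)
        \<cdot>\<^sub>m outer_prod (col VC i) (col VC i)) {..<M} \<and>
    expectation_mat P N N (\<lambda>\<omega>. Y \<omega> * transpose_mat (Y \<omega>)) =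
      mat_sum N N (\<lambda>j. (\<Sum>i<M. \<bar>filter_fun TG TC h (LC $$ (i, i)) (LG $$ (j, j))\<bar>\<^sup>2)
        \<cdot>\<^sub>m outer_prod (col VG j) (col VG j)) {..<N}"
proof -
  let ?g = "\<lambda>a b. filter_fun TG TC h (LC $$ (a, a)) (LG $$ (b, b))"
  let ?H = "filter_mat TG TC h AC AG"
  let ?S = "{..<M} \<times> {..<N}"
  have VC: "orthonormal_mat M VC" "VC \<in> carrier_mat M M"
    and VG: "orthonormal_mat N VG" "VG \<in> carrier_mat N N"
    using assms(5,6) by (auto simp: sorted_eigendecomposition_def orthonormal_mat_def)
  have H: "?H \<in> carrier_mat (N * M) (N * M)"
    using assms(1,3) by (auto simp: filter_mat_def mult.commute)
  have y: "y \<omega> $ k = (?H *\<^sub>v x \<omega>) $ k" for \<omega> k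
    by (simp add: assms(13))
  \<comment> \<open>Allows the expectation to be exchanged with the sums over nodes and over layers
    below.\<close>
  have int: "integrable P (\<lambda>\<omega>. y \<omega> $ (m * N + i) * y \<omega> $ (n * N + j))"
    if "m < M" "i < N" "n < M" "j < N" for m i n j
    unfolding y using that by (intro white_vec_image_second_moment(1)[OF assms(10,12) H] mult_add_less)
  \<comment> \<open>Covariance between node \<open>i\<close> of layer \<open>m\<close> and node
    \<open>j\<close> of layer \<open>n\<close>. The coupling and physical eigenvectors appear as
    separate factors, so either can be summed out alone.\<close>
  have cov: "(\<integral>\<omega>. y \<omega> $ (m * N + i) * y \<omega> $ (n * N + j) \<partial>P) =
      (\<Sum>a<M. \<Sum>b<N. (?g a b)\<^sup>2 * (VC $$ (m, a) * VC $$ (n, a)) * (VG $$ (i, b) * VG $$ (j, b)))"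
    if "m < M" "i < N" "n < M" "j < N" for m i n j
  proof -
    have less: "m * N + i < N * M" "n * N + j < N * M"
      using that by (auto intro: mult_add_less)
    have "(\<integral>\<omega>. y \<omega> $ (m * N + i) * y \<omega> $ (n * N + j) \<partial>P) =
        (\<Sum>p<N * M. ?H $$ (m * N + i, p) * ?H $$ (n * N + j, p))"
      unfolding y by (rule white_vec_image_second_moment(2)[OF assms(10,12) H less])
    also have "\<dots> = (\<Sum>(a, b)\<in>?S. (?g a b)\<^sup>2 *
        kron_eigvec N VC VG (a, b) (m * N + i) * kron_eigvec N VC VG (a, b) (n * N + j))"
      by (rule filter_mat_gram_index[OF assms(1,3,5,6,7) less])
    also have "\<dots> = (\<Sum>a<M. \<Sum>b<N.
        (?g a b)\<^sup>2 * (VC $$ (m, a) * VC $$ (n, a)) * (VG $$ (i, b) * VG $$ (j, b)))"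
      using that by (simp add: kron_eigvec_block mult.assoc mult.left_commute flip: sum.cartesian_product)
    finally show ?thesis .
  qed
  \<comment> \<open>Partial trace over the nodes: the two node indices coincide and are
    summed.\<close>
  have layer: "(\<integral>\<omega>. (transpose_mat (Y \<omega>) * Y \<omega>) $$ (m, n) \<partial>P) =
      (\<Sum>a<M. (\<Sum>b<N. (?g a b)\<^sup>2) * (VC $$ (m, a) * VC $$ (n, a)))" if "m < M" "n < M" for m n
  proof -
    have "(\<integral>\<omega>. (transpose_mat (Y \<omega>) * Y \<omega>) $$ (m, n) \<partial>P) =
        (\<integral>\<omega>. (\<Sum>i<N. y \<omega> $ (m * N + i) * y \<omega> $ (n * N + i)) \<partial>P)"
      using that by (simp add: assms(14) unfolding_mat_def scalar_prod_def lessThan_atLeast0)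
    also have "\<dots> = (\<Sum>i<N. \<integral>\<omega>. y \<omega> $ (m * N + i) * y \<omega> $ (n * N + i) \<partial>P)"
      using that by (intro Bochner_Integration.integral_sum int) auto
    also have "\<dots> = (\<Sum>i<N. \<Sum>a<M. \<Sum>b<N.
        (?g a b)\<^sup>2 * (VC $$ (m, a) * VC $$ (n, a)) * (VG $$ (i, b) * VG $$ (i, b)))"
      using that by (simp add: cov)
    also have "\<dots> = (\<Sum>a<M. \<Sum>i<N. \<Sum>b<N.
        (?g a b)\<^sup>2 * (VC $$ (m, a) * VC $$ (n, a)) * (VG $$ (i, b) * VG $$ (i, b)))"
      by (rule sum.swap)
    also have "\<dots> = (\<Sum>a<M. \<Sum>b<N. \<Sum>i<N.
        (?g a b)\<^sup>2 * (VC $$ (m, a) * VC $$ (n, a)) * (VG $$ (i, b) * VG $$ (i, b)))"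
      by (intro sum.cong refl sum.swap)
    \<comment> \<open>The sum over \<open>i\<close> is the squared norm of column \<open>b\<close>
      of \<open>VG\<close>, which is 1.\<close>
    also have "\<dots> = (\<Sum>a<M. \<Sum>b<N. (?g a b)\<^sup>2 * (VC $$ (m, a) * VC $$ (n, a)))"
      by (simp flip: sum_distrib_left add: orthonormal_mat_cols[OF VG(1)])
    finally show ?thesis
      by (simp add: sum_distrib_right)
  qed
  \<comment> \<open>The mirror image: the layers are traced out, and the columns of
    \<open>VC\<close> contribute their squared norm 1.\<close>
  have node: "(\<integral>\<omega>. (Y \<omega> * transpose_mat (Y \<omega>)) $$ (i, j) \<partial>P) =
      (\<Sum>b<N. (\<Sum>a<M. (?g a b)\<^sup>2) * (VG $$ (i, b) * VG $$ (j, b)))" if "i < N" "j < N" for i j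
  proof -
    have "(\<integral>\<omega>. (Y \<omega> * transpose_mat (Y \<omega>)) $$ (i, j) \<partial>P) =
        (\<integral>\<omega>. (\<Sum>m<M. y \<omega> $ (m * N + i) * y \<omega> $ (m * N + j)) \<partial>P)"
      using that by (simp add: assms(14) unfolding_mat_def scalar_prod_def lessThan_atLeast0)
    also have "\<dots> = (\<Sum>m<M. \<integral>\<omega>. y \<omega> $ (m * N + i) * y \<omega> $ (m * N + j) \<partial>P)"
      using that by (intro Bochner_Integration.integral_sum int) auto
    \<comment> \<open>The sums over \<open>a\<close> and \<open>b\<close> are also interchanged
      here, since the result is indexed by the physical eigenvectors.\<close>
    also have "\<dots> = (\<Sum>m<M. \<Sum>b<N. \<Sum>a<M.
        (?g a b)\<^sup>2 * (VG $$ (i, b) * VG $$ (j, b)) * (VC $$ (m, a) * VC $$ (m, a)))"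
      using that by (simp add: cov sum.swap[of _ "{..<N}" "{..<M}"] mult_ac)
    also have "\<dots> = (\<Sum>b<N. \<Sum>m<M. \<Sum>a<M.
        (?g a b)\<^sup>2 * (VG $$ (i, b) * VG $$ (j, b)) * (VC $$ (m, a) * VC $$ (m, a)))"
      by (rule sum.swap)
    also have "\<dots> = (\<Sum>b<N. \<Sum>a<M. \<Sum>m<M.
        (?g a b)\<^sup>2 * (VG $$ (i, b) * VG $$ (j, b)) * (VC $$ (m, a) * VC $$ (m, a)))"
      by (intro sum.cong refl sum.swap)
    also have "\<dots> = (\<Sum>b<N. \<Sum>a<M. (?g a b)\<^sup>2 * (VG $$ (i, b) * VG $$ (j, b)))"
      by (simp flip: sum_distrib_left add: orthonormal_mat_cols[OF VC(1)])
    finally show ?thesis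
      by (simp add: sum_distrib_right)
  qed
  \<comment> \<open>Entrywise comparison with the sums of outer products; the absolute value
    disappears because the filter values are real and squared.\<close>
  show ?thesis
  proof
    show "expectation_mat P M M (\<lambda>\<omega>. transpose_mat (Y \<omega>) * Y \<omega>) =
        mat_sum M M (\<lambda>i. (\<Sum>j<N. \<bar>?g i j\<bar>\<^sup>2) \<cdot>\<^sub>m outer_prod (col VC i) (col VC i)) {..<M}"
      using VC(2) by (intro eq_matI)
        (simp_all add: expectation_mat_def mat_sum_def outer_prod_def layer del: index_mult_mat(1))
    show "expectation_mat P N N (\<lambda>\<omega>. Y \<omega> * transpose_mat (Y \<omega>)) =
        mat_sum N N (\<lambda>j. (\<Sum>i<M. \<bar>?g i j\<bar>\<^sup>2) \<cdot>\<^sub>m outer_prod (col VG j) (col VG j)) {..<N}"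
      using VG(2) by (intro eq_matI)
        (simp_all add: expectation_mat_def mat_sum_def outer_prod_def node del: index_mult_mat(1))
  qed
qed

end
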